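(* Let $(E,\|\cdot\|)$ be a finite-dimensional Euclidean space and let $f:E\to\mathbb{R}$ be $L$-smooth (possibly nonconvex). Let $\psi^*(\mathbf{z})=\frac{1}{2\mu}\|\mathbf{z}\|^2$ with $\mu>0$, let $a_i>0$, $A_k=\sum_{i=0}^k a_i$, and suppose $\frac{\mu}{LH_i}=1$ and $\frac{a_i^2}{A_i^2}=c$ for all $i\ge1$, with $c\in(0,1)$. Let $\mathbf{x}_0=\mathbf{y}_0=\nabla\psi^*(\mathbf{z}_0)$ be arbitrary and let $\mathbf{x}_k,\mathbf{y}_k,\mathbf{z}_k$ evolve, for $k\ge1$, according to $$\mathbf{x}_k=\frac{A_{k-1}}{A_k}\mathbf{y}_{k-1}+\frac{a_k}{A_k}\nabla\psi^*(\mathbf{z}_{k-1}),\quad \mathbf{z}_k=\mathbf{z}_{k-1}-\frac{a_k}{A_k}H_k\nabla f(\mathbf{x}_k),\quad \mathbf{y}_k=\mathbf{x}_k+\frac{a_k}{A_k}\left(\nabla\psi^*(\mathbf{z}_k)-\nabla\psi^*(\mathbf{z}_{k-1})\right).$$ Then, for all $k\ge1$, $$\min_{1\le i\le k}\|\nabla f(\mathbf{x}_i)\|^2=O\left(\frac{L(f(\mathbf{x}_0)-f(\mathbf{x}^* ))}{c(1-c)k+\sqrt{c}(1-\sqrt{c})ck}\right).$$ In particular, for $c=\frac12$, $\min_{1\le i\le k}\|\nabla f(\mathbf{x}_i)\|^2=O\left(\frac{L(f(\mathbf{x}_0)-f(\mathbf{x}^* ))}{k}\right)$.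
   Context: $f$ is continuously differentiable, and $L$-smooth ($L>0$) means $\|\nabla f(\mathbf{x})-\nabla f(\mathbf{y})\|\le L\|\mathbf{x}-\mathbf{y}\|$ for all $\mathbf{x},\mathbf{y}\in E$. $\mathbf{x}^*\in\mathrm{argmin}_{\mathbf{x}\in E}f(\mathbf{x})$ is any fixed minimizer. The Euclidean space is identified with its dual; $\psi^*$ is the convex conjugate of $\psi(\mathbf{x})=\frac{\mu}{2}\|\mathbf{x}\|^2$, so $\nabla\psi^*(\mathbf{z})=\mathbf{z}/\mu$. *)

theory Defs
  imports "HOL-Analysis.Analysis"
begin

(* A Euclidean space is rendered as a finite-dimensional subspace E of a real inner product
   space, with the inherited norm, rather than as a type of class euclidean_space (which is the
   instance E = UNIV): a constant hidden in an O-bound can then be quantified outside E. Taking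
   the ambient space infinite-dimensional, the constant is independent of the dimension, as
   every Euclidean space embeds isometrically. *)
definition euclidean_subspace :: "'a::real_inner set \<Rightarrow> bool" where
  "euclidean_subspace E \<longleftrightarrow> subspace E \<and> (\<exists>B. finite B \<and> span B = E)"

(* Relative version of GDERIV. The condition that g lies in E makes it unique. *)
definition has_gradient :: "'a::real_inner set \<Rightarrow> ('a \<Rightarrow> real) \<Rightarrow> 'a \<Rightarrow> 'a \<Rightarrow> bool" where
  "has_gradient E f x g \<longleftrightarrow> g \<in> E \<and> (f has_derivative (\<lambda>h. inner h g)) (at x within E)"

definition grad :: "'a::real_inner set \<Rightarrow> ('a \<Rightarrow> real) \<Rightarrow> 'a \<Rightarrow> 'a" where
  "grad E f x = (THE g. has_gradient E f x g)"

definition C1 :: "'a::real_inner set \<Rightarrow> ('a \<Rightarrow> real) \<Rightarrow> bool" where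
  "C1 E f \<longleftrightarrow> (\<forall>x\<in>E. \<exists>g. has_gradient E f x g) \<and> continuous_on E (grad E f)"

definition L_smooth :: "'a::real_inner set \<Rightarrow> real \<Rightarrow> ('a \<Rightarrow> real) \<Rightarrow> bool" where
  "L_smooth E L f \<longleftrightarrow> C1 E f \<and>
     (\<forall>x\<in>E. \<forall>y\<in>E. norm (grad E f x - grad E f y) \<le> L * norm (x - y))"

definition psi_star :: "real \<Rightarrow> 'a::real_inner \<Rightarrow> real" where
  "psi_star \<mu> z = 1 / (2 * \<mu>) * (norm z)\<^sup>2"

definition partial_sum :: "(nat \<Rightarrow> real) \<Rightarrow> nat \<Rightarrow> real" where
  "partial_sum a k = (\<Sum>i\<le>k. a i)"

definition iterates ::
  "'a::real_inner set \<Rightarrow> ('a \<Rightarrow> real) \<Rightarrow> real \<Rightarrow> (nat \<Rightarrow> real) \<Rightarrow> (nat \<Rightarrow> real) \<Rightarrow>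
   (nat \<Rightarrow> 'a) \<Rightarrow> (nat \<Rightarrow> 'a) \<Rightarrow> (nat \<Rightarrow> 'a) \<Rightarrow> bool" where
  "iterates E f \<mu> a H x y z \<longleftrightarrow>
     z 0 \<in> E \<and> x 0 = grad E (psi_star \<mu>) (z 0) \<and> y 0 = grad E (psi_star \<mu>) (z 0) \<and>
     (\<forall>k\<ge>1.
        x k = (partial_sum a (k - 1) / partial_sum a k) *\<^sub>R y (k - 1)
              + (a k / partial_sum a k) *\<^sub>R grad E (psi_star \<mu>) (z (k - 1)) \<and>
        z k = z (k - 1) - (a k / partial_sum a k * H k) *\<^sub>R grad E f (x k) \<and>
        y k = x k + (a k / partial_sum a k) *\<^sub>R
                (grad E (psi_star \<mu>) (z k) - grad E (psi_star \<mu>) (z (k - 1))))"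

definition setting ::
  "'a::real_inner set \<Rightarrow> ('a \<Rightarrow> real) \<Rightarrow> real \<Rightarrow> real \<Rightarrow> real \<Rightarrow> (nat \<Rightarrow> real) \<Rightarrow> (nat \<Rightarrow> real) \<Rightarrow>
   (nat \<Rightarrow> 'a) \<Rightarrow> (nat \<Rightarrow> 'a) \<Rightarrow> (nat \<Rightarrow> 'a) \<Rightarrow> 'a \<Rightarrow> bool" where
  "setting E f L \<mu> c a H x y z xstar \<longleftrightarrow>
     euclidean_subspace E \<and> L > 0 \<and> L_smooth E L f \<and> \<mu> > 0 \<and>
     (\<forall>i. a i > 0) \<and> 0 < c \<and> c < 1 \<and>
     (\<forall>i\<ge>1. \<mu> / (L * H i) = 1 \<and> (a i)\<^sup>2 / (partial_sum a i)\<^sup>2 = c) \<and>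
     iterates E f \<mu> a H x y z \<and>
     is_arg_min f (\<lambda>u. u \<in> E) xstar"

lemma has_gradient_unique:
  fixes E :: "'a::real_inner set"
  assumes E: "subspace E" "x \<in> E" and g: "has_gradient E f x g" and g': "has_gradient E f x g'"
  shows "g = g'"
proof -
  define d where "d = g - g'"
  have dE: "d \<in> E"
    using assms unfolding d_def has_gradient_def by (simp add: subspace_diff)
  define \<gamma> where "\<gamma> = (\<lambda>t::real. x + t *\<^sub>R d)"
  have sub: "range \<gamma> \<subseteq> E"
    using E dE by (auto simp: \<gamma>_def subspace_add subspace_scale)
  have \<gamma>: "(\<gamma> has_derivative (\<lambda>t. t *\<^sub>R d)) (at 0)"
    unfolding \<gamma>_def by (auto intro!: derivative_eq_intros)
  have *: "((\<lambda>t. f (\<gamma> t)) has_derivative (\<lambda>t. inner (t *\<^sub>R d) u)) (at 0)"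
    if "has_gradient E f x u" for u
  proof (rule has_derivative_in_compose[OF \<gamma>])
    have "(f has_derivative (\<lambda>h. inner h u)) (at (\<gamma> 0) within E)"
      using that unfolding has_gradient_def by (simp add: \<gamma>_def)
    then show "(f has_derivative (\<lambda>h. inner h u)) (at (\<gamma> 0) within range \<gamma>)"
      using sub by (rule has_derivative_subset)
  qed
  have "(\<lambda>t. inner (t *\<^sub>R d) g) = (\<lambda>t. inner (t *\<^sub>R d) g')"
    using has_derivative_unique[OF *[OF g] *[OF g']] .
  then have "inner (1 *\<^sub>R d) g = inner (1 *\<^sub>R d) g'" by metis
  then have "inner d d = 0" by (simp add: d_def inner_diff_right)
  then show ?thesis by (simp add: d_def)
qed

lemma grad_eqI:
  assumes "subspace E" "x \<in> E" "has_gradient E f x g"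
  shows "grad E f x = g"
  unfolding grad_def using assms has_gradient_unique by blast

lemma grad_psi_star:
  fixes E :: "'a::real_inner set"
  assumes "subspace E" "z \<in> E" "\<mu> > 0"
  shows "grad E (psi_star \<mu>) z = z /\<^sub>R \<mu>"
proof (rule grad_eqI)
  have "(psi_star \<mu> has_derivative (\<lambda>h. inner h (z /\<^sub>R \<mu>))) (at z within E)"
    unfolding psi_star_def power2_norm_eq_inner using assms(3)
    by (auto intro!: derivative_eq_intros simp: inner_commute field_simps)
  then show "has_gradient E (psi_star \<mu>) z (z /\<^sub>R \<mu>)"
    using assms by (simp add: has_gradient_def subspace_scale)
qed (use assms in auto)

end

theory Submission imports Defs begin

text \<open>
  Write \<open>s = sqrt c\<close> and \<open>v\<^sub>k = z\<^sub>k / \<mu>\<close>, and let \<open>g\<^sub>k\<close> be the gradient at \<open>x\<^sub>k\<close>. The hypotheses say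
  that \<open>a\<^sub>k / A\<^sub>k = s\<close> and \<open>H\<^sub>k = \<mu> / L\<close>, so the method becomes autonomous: in terms of \<open>y\<^sub>k\<close> and
  the momentum \<open>w\<^sub>k = v\<^sub>k - y\<^sub>k\<close>, which starts at \<open>0\<close>, it reads
  \<open>x\<^sub>k = y\<^sub>k\<^sub>-\<^sub>1 + s w\<^sub>k\<^sub>-\<^sub>1\<close>, \<open>y\<^sub>k = x\<^sub>k - (s\<^sup>2/L) g\<^sub>k\<close> and
  \<open>w\<^sub>k = (1 - s) (w\<^sub>k\<^sub>-\<^sub>1 - (s/L) g\<^sub>k)\<close>.

  Without convexity the extrapolation from \<open>y\<^sub>k\<^sub>-\<^sub>1\<close> to \<open>x\<^sub>k\<close> may increase \<open>f\<close>, by at most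
  \<open>s\<langle>g\<^sub>k, w\<^sub>k\<^sub>-\<^sub>1\<rangle> + (L s\<^sup>2/2) |w\<^sub>k\<^sub>-\<^sub>1|\<^sup>2\<close> (the lower quadratic bound of a smooth function). The
  energy \<open>f(y\<^sub>k) + L/(2(1-s)\<^sup>2) |w\<^sub>k|\<^sup>2\<close> absorbs this: its weight is the one for which expanding
  \<open>|w\<^sub>k|\<^sup>2\<close> cancels the inner product exactly, and the contraction \<open>1 - s\<close> of the momentum is
  strong enough to pay for the quadratic term. What is left (\<open>energy_decrease\<close>) is a decrease of
  \<open>c(1-c)/(2L) |g\<^sub>k|\<^sup>2\<close> per step. Summing over the steps bounds the sum of the squared gradient
  norms by \<open>2L (f(x\<^sub>0) - f(x\<^sup>*)) / (c(1-c))\<close>. Finally \<open>s(1-s) \<le> 1 - c\<close>, so the second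
  summand of the denominator in the claim is at most the first and costs only a factor \<open>2\<close>.
\<close>

section \<open>Quadratic bounds for smooth functions\<close>

text \<open>
  The gradient is taken as an explicit function \<open>G\<close>, rather than as \<open>grad\<close>, so that the lemma
  also applies to \<open>- f\<close> and \<open>- G\<close>, which gives the lower bound. Along the segment, the excess of
  \<open>F\<close> over the quadratic model has derivative at most \<open>0\<close> by Cauchy-Schwarz.
\<close>
lemma lipschitz_gradient_upper_bound:
  fixes E :: "'a::real_inner set"
  assumes E: "subspace E" and x: "x \<in> E" and y: "y \<in> E"
    and G: "\<And>u. u \<in> E \<Longrightarrow> has_gradient E F u (G u)"
    and lip: "\<And>u v. u \<in> E \<Longrightarrow> v \<in> E \<Longrightarrow> norm (G u - G v) \<le> L * norm (u - v)"
  shows "F y \<le> F x + inner (G x) (y - x) + L / 2 * (norm (y - x))\<^sup>2"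
proof -
  define d where "d = y - x"
  define \<gamma> where "\<gamma> = (\<lambda>t::real. x + t *\<^sub>R d)"
  define \<phi> where "\<phi> = (\<lambda>t. F (\<gamma> t) - t * inner (G x) d - L / 2 * t\<^sup>2 * (norm d)\<^sup>2)"
  have \<gamma>E: "\<gamma> t \<in> E" for t
    using E x y by (simp add: \<gamma>_def d_def subspace_add subspace_diff subspace_scale)
  have dF: "((\<lambda>t. F (\<gamma> t)) has_real_derivative inner d (G (\<gamma> t))) (at t)" for t
  proof -
    have \<gamma>': "(\<gamma> has_derivative (\<lambda>h. h *\<^sub>R d)) (at t)"
      unfolding \<gamma>_def by (auto intro!: derivative_eq_intros)
    have "(F has_derivative (\<lambda>h. inner h (G (\<gamma> t)))) (at (\<gamma> t) within range \<gamma>)"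
      using G[OF \<gamma>E[of t]] \<gamma>E unfolding has_gradient_def
      by (blast intro: has_derivative_subset)
    from has_derivative_in_compose[OF \<gamma>' this] show ?thesis
      by (rule has_derivative_imp_has_field_derivative) simp
  qed
  have d\<phi>: "(\<phi> has_real_derivative inner d (G (\<gamma> t)) - inner (G x) d - L * t * (norm d)\<^sup>2) (at t)"
    for t
    unfolding \<phi>_def by (rule derivative_eq_intros dF refl | simp)+
  have d\<phi>_le: "inner d (G (\<gamma> t)) - inner (G x) d - L * t * (norm d)\<^sup>2 \<le> 0" if "0 \<le> t" for t
  proof -
    have "inner d (G (\<gamma> t)) - inner (G x) d = inner d (G (\<gamma> t) - G x)"
      by (simp add: inner_diff_right inner_commute)
    also have "\<dots> \<le> norm d * norm (G (\<gamma> t) - G x)"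
      by (rule norm_cauchy_schwarz)
    also have "\<dots> \<le> norm d * (L * norm (\<gamma> t - x))"
      by (intro mult_left_mono lip \<gamma>E x) simp
    also have "\<dots> = L * t * (norm d)\<^sup>2"
      using that by (simp add: \<gamma>_def power2_eq_square)
    finally show ?thesis by simp
  qed
  have "\<phi> 1 \<le> \<phi> 0"
  proof (rule DERIV_nonpos_imp_nonincreasing[of 0 1 \<phi>])
    show "\<exists>D. DERIV \<phi> t :> D \<and> D \<le> 0" if "0 \<le> t" "t \<le> 1" for t
      using d\<phi>[of t] d\<phi>_le[OF that(1)] by blast
  qed simp
  then show ?thesis
    by (simp add: \<phi>_def \<gamma>_def d_def)
qed

lemma L_smooth_has_gradient:
  assumes "euclidean_subspace E" "L_smooth E L f" "u \<in> E"
  shows "has_gradient E f u (grad E f u)"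
proof -
  obtain g where "has_gradient E f u g"
    using assms unfolding L_smooth_def C1_def by blast
  with assms show ?thesis
    using grad_eqI[of E u f g] by (simp add: euclidean_subspace_def)
qed

lemma L_smooth_quadratic_bounds:
  assumes E: "euclidean_subspace E" and f: "L_smooth E L f" and xy: "x \<in> E" "y \<in> E"
  shows "f y \<le> f x + inner (grad E f x) (y - x) + L / 2 * (norm (y - x))\<^sup>2"
    and "f x + inner (grad E f x) (y - x) - L / 2 * (norm (y - x))\<^sup>2 \<le> f y"
proof -
  have sub: "subspace E"
    using E by (simp add: euclidean_subspace_def)
  have lip: "norm (grad E f u - grad E f v) \<le> L * norm (u - v)" if "u \<in> E" "v \<in> E" for u v
    using f that by (simp add: L_smooth_def)
  note G = L_smooth_has_gradient[OF E f]
  show "f y \<le> f x + inner (grad E f x) (y - x) + L / 2 * (norm (y - x))\<^sup>2"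
    by (rule lipschitz_gradient_upper_bound[OF sub xy G lip])
  have negG: "has_gradient E (\<lambda>u. - f u) u (- grad E f u)" if "u \<in> E" for u
    using G[OF that] sub unfolding has_gradient_def
    by (auto intro: has_derivative_minus simp: subspace_neg)
  have neglip: "norm (- grad E f u - - grad E f v) \<le> L * norm (u - v)"
    if "u \<in> E" "v \<in> E" for u v
    using lip[OF that] by (simp add: norm_minus_commute)
  show "f x + inner (grad E f x) (y - x) - L / 2 * (norm (y - x))\<^sup>2 \<le> f y"
    using lipschitz_gradient_upper_bound[OF sub xy negG neglip] by simp
qed

section \<open>Decrease of the energy\<close>

text \<open>
  Here \<open>w\<close> and \<open>(1 - s) (w - (s/L) g)\<close> are the momenta before and after a step. The weight
  \<open>L / (2 (1 - s)\<^sup>2)\<close> turns the new momentum term into \<open>L/2 |w - (s/L) g|\<^sup>2\<close>, whose cross term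
  is \<open>- s\<langle>g, w\<rangle>\<close>, the opposite of the one in the bound on \<open>fx\<close>. The coefficient of \<open>|w|\<^sup>2\<close> then
  does not grow because \<open>(1 + s\<^sup>2) (1 - s)\<^sup>2 \<le> 1\<close>.
\<close>
lemma energy_decrease:
  fixes g w :: "'a::real_inner"
  assumes s: "0 < s" "s < 1" and L: "L > 0"
    and fx: "fx \<le> fy + s * inner g w + L / 2 * s\<^sup>2 * (norm w)\<^sup>2"
    and fy': "fy' \<le> fx - s\<^sup>2 / L * (1 - s\<^sup>2 / 2) * (norm g)\<^sup>2"
  shows "fy' + L / (2 * (1 - s)\<^sup>2) * (norm ((1 - s) *\<^sub>R (w - (s / L) *\<^sub>R g)))\<^sup>2
           \<le> fy + L / (2 * (1 - s)\<^sup>2) * (norm w)\<^sup>2 - s\<^sup>2 * (1 - s\<^sup>2) / (2 * L) * (norm g)\<^sup>2"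
proof -
  have "L / (2 * (1 - s)\<^sup>2) * (norm ((1 - s) *\<^sub>R (w - (s / L) *\<^sub>R g)))\<^sup>2
          = L / 2 * (norm (w - (s / L) *\<^sub>R g))\<^sup>2"
    using s by (simp add: power_mult_distrib)
  also have "(norm (w - (s / L) *\<^sub>R g))\<^sup>2
               = (norm w)\<^sup>2 - 2 * (s / L) * inner g w + (s / L)\<^sup>2 * (norm g)\<^sup>2"
    unfolding power2_norm_eq_inner
    by (simp add: inner_diff_left inner_diff_right inner_commute power2_eq_square)
  also have "L / 2 * \<dots> = L / 2 * (norm w)\<^sup>2 - s * inner g w + s\<^sup>2 / (2 * L) * (norm g)\<^sup>2"
    using L by (simp add: field_simps power2_eq_square)
  finally have w': "L / (2 * (1 - s)\<^sup>2) * (norm ((1 - s) *\<^sub>R (w - (s / L) *\<^sub>R g)))\<^sup>2 = \<dots>" .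
  have "1 - (1 + s\<^sup>2) * (1 - s)\<^sup>2 = s * ((1 - s) * (1 + s\<^sup>2) + (1 - s + s\<^sup>2))"
    by (simp add: algebra_simps power2_eq_square)
  also have "0 \<le> \<dots>"
    using s by (intro mult_nonneg_nonneg add_nonneg_nonneg) auto
  finally have "(1 + s\<^sup>2) * (1 - s)\<^sup>2 \<le> 1"
    by simp
  then have "1 + s\<^sup>2 \<le> 1 / (1 - s)\<^sup>2"
    using s by (simp add: pos_le_divide_eq)
  then have "L / 2 * (norm w)\<^sup>2 * (1 + s\<^sup>2) \<le> L / 2 * (norm w)\<^sup>2 * (1 / (1 - s)\<^sup>2)"
    using L by (intro mult_left_mono) auto
  then have ww: "L / 2 * (norm w)\<^sup>2 + L / 2 * s\<^sup>2 * (norm w)\<^sup>2 \<le> L / (2 * (1 - s)\<^sup>2) * (norm w)\<^sup>2"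
    by (simp add: algebra_simps)
  have gg: "s\<^sup>2 / (2 * L) * (norm g)\<^sup>2 - s\<^sup>2 / L * (1 - s\<^sup>2 / 2) * (norm g)\<^sup>2
              = - (s\<^sup>2 * (1 - s\<^sup>2) / (2 * L) * (norm g)\<^sup>2)"
    using L by (simp add: field_simps)
  show ?thesis
    using fx fy' ww gg unfolding w' by linarith
qed

section \<open>The iteration with constant coefficients\<close>

lemma setting_coefficients:
  assumes S: "setting E f L \<mu> c a H x y z xstar" and k: "k \<ge> 1"
  shows "a k / partial_sum a k = sqrt c"
    and "partial_sum a (k - 1) / partial_sum a k = 1 - sqrt c"
    and "H k = \<mu> / L"
proof -
  have a: "a i > 0" for i
    using S by (simp add: setting_def)
  have A: "partial_sum a k > 0"
    unfolding partial_sum_def using a by (intro sum_pos) auto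
  have "(a k / partial_sum a k)\<^sup>2 = c"
    using S k by (simp add: setting_def power_divide)
  then show s: "a k / partial_sum a k = sqrt c"
    using a[of k] A by (intro real_sqrt_unique[symmetric]) auto
  have "partial_sum a k = partial_sum a (k - 1) + a k"
    using k by (cases k) (auto simp: partial_sum_def)
  then show "partial_sum a (k - 1) / partial_sum a k = 1 - sqrt c"
    using A s by (simp add: field_simps)
  have "\<mu> / (L * H k) = 1"
    using S k by (simp add: setting_def)
  moreover have "L > 0"
    using S by (simp add: setting_def)
  ultimately show "H k = \<mu> / L"
    by (cases "H k = 0") (auto simp: field_simps)
qed

text \<open>
  The momentum form of the method. Membership in \<open>E\<close> is proved together with the recursion,
  because \<open>grad E (psi_star \<mu>) (z n)\<close> equals \<open>z n / \<mu>\<close> by \<open>grad_psi_star\<close> once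
  \<open>z n\<close> is in \<open>E\<close>.
\<close>
lemma setting_momentum_form:
  assumes S: "setting E f L \<mu> c a H x y z xstar"
  defines "w \<equiv> \<lambda>n. z n /\<^sub>R \<mu> - y n"
  shows "y 0 = x 0" and "w 0 = 0" and "y n \<in> E" and "w n \<in> E"
    and "x (Suc n) = y n + sqrt c *\<^sub>R w n"
    and "x (Suc n) \<in> E"
    and "y (Suc n) = x (Suc n) - (c / L) *\<^sub>R grad E f (x (Suc n))"
    and "w (Suc n) = (1 - sqrt c) *\<^sub>R (w n - (sqrt c / L) *\<^sub>R grad E f (x (Suc n)))"
proof -
  define s where "s = sqrt c"
  have E: "subspace E" and smooth: "L_smooth E L f" and pos: "L > 0" "\<mu> > 0" "c > 0"
    and it: "iterates E f \<mu> a H x y z" and E': "euclidean_subspace E"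
    using S by (auto simp: setting_def euclidean_subspace_def)
  have ss: "s * s = c"
    using pos by (simp add: s_def)
  note mem = subspace_add[OF E] subspace_diff[OF E] subspace_scale[OF E]
  have psi: "grad E (psi_star \<mu>) u = u /\<^sub>R \<mu>" if "u \<in> E" for u
    using grad_psi_star[OF E that] pos by simp
  have gradE: "grad E f u \<in> E" if "u \<in> E" for u
    using L_smooth_has_gradient[OF E' smooth that] by (simp add: has_gradient_def)
  have z0: "z 0 \<in> E" and xy0: "x 0 = z 0 /\<^sub>R \<mu>" "y 0 = z 0 /\<^sub>R \<mu>"
    using it psi by (auto simp: iterates_def)
  have step: "z (Suc m) \<in> E \<and> y (Suc m) \<in> E \<and> x (Suc m) \<in> E \<and>
      x (Suc m) = y m + s *\<^sub>R w m \<and>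
      y (Suc m) = x (Suc m) - (c / L) *\<^sub>R grad E f (x (Suc m)) \<and>
      w (Suc m) = (1 - s) *\<^sub>R (w m - (s / L) *\<^sub>R grad E f (x (Suc m)))"
    if zm: "z m \<in> E" and ym: "y m \<in> E" for m
  proof -
    define g where "g = grad E f (x (Suc m))"
    have it': "x (Suc m) = (partial_sum a (Suc m - 1) / partial_sum a (Suc m)) *\<^sub>R y (Suc m - 1)
          + (a (Suc m) / partial_sum a (Suc m)) *\<^sub>R grad E (psi_star \<mu>) (z (Suc m - 1))"
        "z (Suc m) = z (Suc m - 1) - (a (Suc m) / partial_sum a (Suc m) * H (Suc m)) *\<^sub>R g"
        "y (Suc m) = x (Suc m) + (a (Suc m) / partial_sum a (Suc m)) *\<^sub>R
            (grad E (psi_star \<mu>) (z (Suc m)) - grad E (psi_star \<mu>) (z (Suc m - 1)))"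
      using it unfolding iterates_def g_def by (metis le_add1 plus_1_eq_Suc)+
    note co = setting_coefficients[OF S, of "Suc m", folded s_def, simplified]
    have x': "x (Suc m) = (1 - s) *\<^sub>R y m + s *\<^sub>R (z m /\<^sub>R \<mu>)"
      using it'(1) co psi[OF zm] by simp
    then have xE: "x (Suc m) \<in> E"
      using zm ym by (simp add: mem)
    then have gE: "g \<in> E"
      by (simp add: g_def gradE)
    have z': "z (Suc m) = z m - (s * (\<mu> / L)) *\<^sub>R g"
      using it'(2) co by simp
    then have zE: "z (Suc m) \<in> E"
      using zm gE by (simp add: mem)
    have zdiff: "z (Suc m) /\<^sub>R \<mu> = z m /\<^sub>R \<mu> - (s / L) *\<^sub>R g"
      using z' pos by (simp add: scaleR_diff_right)
    have y': "y (Suc m) = x (Suc m) - (c / L) *\<^sub>R g"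
      using it'(3) co psi[OF zm] psi[OF zE] zdiff ss by simp
    then have yE: "y (Suc m) \<in> E"
      using xE gE by (simp add: mem)
    have xw: "x (Suc m) = y m + s *\<^sub>R w m"
      using x' by (simp add: w_def algebra_simps)
    have "w (Suc m) = w m - s *\<^sub>R w m - (s / L) *\<^sub>R g + (c / L) *\<^sub>R g"
      unfolding w_def y' zdiff xw by simp
    also have "\<dots> = (1 - s) *\<^sub>R (w m - (s / L) *\<^sub>R g)"
      unfolding ss[symmetric] by (simp add: algebra_simps diff_divide_distrib)
    finally show ?thesis
      using zE yE xE xw y' by (simp add: g_def)
  qed
  have "z n \<in> E \<and> y n \<in> E"
  proof (induction n)
    case 0
    show ?case using z0 xy0 by (simp add: mem)
  qed (use step in blast)
  then have n: "z n \<in> E" "y n \<in> E"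
    by auto
  show "y 0 = x 0" "w 0 = 0" "y n \<in> E" "w n \<in> E"
    using xy0 n by (auto simp: w_def mem)
  show "x (Suc n) = y n + sqrt c *\<^sub>R w n" "x (Suc n) \<in> E"
      "y (Suc n) = x (Suc n) - (c / L) *\<^sub>R grad E f (x (Suc n))"
      "w (Suc n) = (1 - sqrt c) *\<^sub>R (w n - (sqrt c / L) *\<^sub>R grad E f (x (Suc n)))"
    using step[OF n] by (auto simp: s_def)
qed

section \<open>The convergence rate\<close>

lemma sum_gradient_norms_bound:
  assumes S: "setting E f L \<mu> c a H x y z xstar"
  shows "c * (1 - c) / (2 * L) * (\<Sum>i=1..k. (norm (grad E f (x i)))\<^sup>2) \<le> f (x 0) - f xstar"
proof -
  define s where "s = sqrt c"
  define w where "w n = z n /\<^sub>R \<mu> - y n" for n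
  define g where "g = (\<lambda>n. grad E f (x n))"
  define \<Phi> where "\<Phi> = (\<lambda>n. f (y n) + L / (2 * (1 - s)\<^sup>2) * (norm (w n))\<^sup>2)"
  have E: "euclidean_subspace E" and f: "L_smooth E L f" and L: "L > 0" and c: "0 < c" "c < 1"
    and min: "is_arg_min f (\<lambda>u. u \<in> E) xstar"
    using S by (auto simp: setting_def)
  have s: "0 < s" "s < 1" "s\<^sup>2 = c"
    using c by (auto simp: s_def)
  note form = setting_momentum_form[OF S, folded s_def w_def]
  have step: "\<Phi> (Suc n) \<le> \<Phi> n - c * (1 - c) / (2 * L) * (norm (g (Suc n)))\<^sup>2" for n
  proof -
    have "f (x (Suc n)) \<le> f (y n) + s * inner (g (Suc n)) (w n) + L / 2 * s\<^sup>2 * (norm (w n))\<^sup>2"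
      using L_smooth_quadratic_bounds(2)[OF E f form(6)[of n] form(3)[of n]]
      unfolding g_def by (simp add: form(5)[of n] power_mult_distrib)
    moreover have "f (y (Suc n)) \<le> f (x (Suc n)) - s\<^sup>2 / L * (1 - s\<^sup>2 / 2) * (norm (g (Suc n)))\<^sup>2"
    proof -
      have "f (y (Suc n)) \<le> f (x (Suc n)) + inner (g (Suc n)) (- ((c / L) *\<^sub>R g (Suc n)))
              + L / 2 * (norm (- ((c / L) *\<^sub>R g (Suc n))))\<^sup>2"
        using L_smooth_quadratic_bounds(1)[OF E f form(6)[of n] form(3)[of "Suc n"]]
        by (simp add: form(7) g_def)
      also have "\<dots> = f (x (Suc n)) - s\<^sup>2 / L * (1 - s\<^sup>2 / 2) * (norm (g (Suc n)))\<^sup>2"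
      proof -
        have "(norm (- ((c / L) *\<^sub>R g (Suc n))))\<^sup>2 = (c / L)\<^sup>2 * (norm (g (Suc n)))\<^sup>2"
          by (simp add: power_mult_distrib power_divide)
        then show ?thesis
          using L unfolding s(3)
          by (simp add: power2_norm_eq_inner[symmetric] field_simps power2_eq_square[of L]
              power2_eq_square[of c] del: norm_minus_cancel norm_scaleR)
      qed
      finally show ?thesis .
    qed
    ultimately have "f (y (Suc n))
          + L / (2 * (1 - s)\<^sup>2) * (norm ((1 - s) *\<^sub>R (w n - (s / L) *\<^sub>R g (Suc n))))\<^sup>2
        \<le> f (y n) + L / (2 * (1 - s)\<^sup>2) * (norm (w n))\<^sup>2
          - s\<^sup>2 * (1 - s\<^sup>2) / (2 * L) * (norm (g (Suc n)))\<^sup>2"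
      by (rule energy_decrease[OF s(1,2) L])
    then show ?thesis
      by (simp only: \<Phi>_def form(8) g_def s(3))
  qed
  have "c * (1 - c) / (2 * L) * (\<Sum>i=1..k. (norm (g i))\<^sup>2) \<le> \<Phi> 0 - \<Phi> k"
  proof (induction k)
    case (Suc k)
    then show ?case
      using step[of k] by (simp add: distrib_left)
  qed simp
  also have "\<Phi> 0 = f (x 0)"
    by (simp add: \<Phi>_def form(1,2))
  also have "f (x 0) - \<Phi> k \<le> f (x 0) - f xstar"
  proof -
    have "f xstar \<le> f (y k)"
      using min form(3)[of k] by (auto simp: is_arg_min_linorder)
    moreover have "0 \<le> L / (2 * (1 - s)\<^sup>2) * (norm (w k))\<^sup>2"
      using L by simp
    ultimately show ?thesis
      by (simp add: \<Phi>_def)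
  qed
  finally show ?thesis
    by (simp add: g_def)
qed

lemma min_gradient_norm_bound:
  assumes S: "setting E f L \<mu> c a H x y z xstar" and k: "k \<ge> 1"
  shows "Min ((\<lambda>i. (norm (grad E f (x i)))\<^sup>2) ` {1..k})
           \<le> 2 * L * (f (x 0) - f xstar) / (c * (1 - c) * real k)"
proof -
  define m where "m = Min ((\<lambda>i. (norm (grad E f (x i)))\<^sup>2) ` {1..k})"
  have L: "L > 0" and c: "0 < c" "c < 1"
    using S by (auto simp: setting_def)
  have "real k * m = (\<Sum>i=1..k. m)"
    by simp
  also have "\<dots> \<le> (\<Sum>i=1..k. (norm (grad E f (x i)))\<^sup>2)"
    unfolding m_def by (intro sum_mono Min_le) auto
  finally have "c * (1 - c) / (2 * L) * (real k * m)
      \<le> c * (1 - c) / (2 * L) * (\<Sum>i=1..k. (norm (grad E f (x i)))\<^sup>2)"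
    using L c by (intro mult_left_mono) auto
  also have "\<dots> \<le> f (x 0) - f xstar"
    by (rule sum_gradient_norms_bound[OF S])
  finally have "c * (1 - c) / (2 * L) * (real k * m) \<le> f (x 0) - f xstar" .
  then have "m * (c * (1 - c) * real k) \<le> 2 * L * (f (x 0) - f xstar)"
    using L by (simp add: field_simps)
  moreover have "0 < c * (1 - c) * real k"
    using c k by simp
  ultimately show ?thesis
    unfolding m_def[symmetric] by (simp add: pos_le_divide_eq)
qed

theorem corollary4p8:
  "(\<exists>C>0. \<forall>(E :: 'a::real_inner set) f L \<mu> c a H x y z xstar.
      setting E f L \<mu> c a H x y z xstar \<longrightarrow>
      (\<forall>k\<ge>1. Min ((\<lambda>i. (norm (grad E f (x i)))\<^sup>2) ` {1..k})
         \<le> C * (L * (f (x 0) - f xstar)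
               / (c * (1 - c) * real k + sqrt c * (1 - sqrt c) * c * real k)))) \<and>
   (\<exists>C>0. \<forall>(E :: 'a::real_inner set) f L \<mu> c a H x y z xstar.
      setting E f L \<mu> c a H x y z xstar \<longrightarrow> c = 1 / 2 \<longrightarrow>
      (\<forall>k\<ge>1. Min ((\<lambda>i. (norm (grad E f (x i)))\<^sup>2) ` {1..k})
         \<le> C * (L * (f (x 0) - f xstar) / real k)))"
proof (intro conjI exI allI impI)
  fix E :: "'a set" and f L \<mu> c a H x y z xstar and k :: nat
  assume S: "setting E f L \<mu> c a H x y z xstar" and k: "1 \<le> k"
  define D where "D = c * (1 - c) * real k + sqrt c * (1 - sqrt c) * c * real k"
  have L: "L > 0" and c: "0 < c" "c < 1"
    using S by (auto simp: setting_def)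
  have gap: "0 \<le> f (x 0) - f xstar"
    using sum_gradient_norms_bound[OF S, of 0] by simp
  have s: "0 < sqrt c" "sqrt c < 1" "(sqrt c)\<^sup>2 = c"
    using c by auto
  have "sqrt c * (1 - sqrt c) \<le> 1 - c"
    using s by (simp add: algebra_simps power2_eq_square)
  then have "sqrt c * (1 - sqrt c) * c * real k \<le> (1 - c) * c * real k"
    using c by (intro mult_right_mono) auto
  then have D: "D \<le> 2 * (c * (1 - c) * real k)"
    unfolding D_def mult.commute[of c "1 - c"] by linarith
  have Dpos: "0 < D"
    unfolding D_def using c s k by (intro add_pos_pos mult_pos_pos) auto
  have "2 * L * (f (x 0) - f xstar) / (c * (1 - c) * real k)
          = 4 * (L * (f (x 0) - f xstar)) / (2 * (c * (1 - c) * real k))"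
    using c k by (simp add: field_simps)
  also have "\<dots> \<le> 4 * (L * (f (x 0) - f xstar)) / D"
    using D Dpos L gap c k by (intro divide_left_mono mult_pos_pos) auto
  finally show "Min ((\<lambda>i. (norm (grad E f (x i)))\<^sup>2) ` {1..k})
      \<le> 4 * (L * (f (x 0) - f xstar)
          / (c * (1 - c) * real k + sqrt c * (1 - sqrt c) * c * real k))"
    using min_gradient_norm_bound[OF S k] unfolding D_def by simp
next
  fix E :: "'a set" and f L \<mu> c a H x y z xstar and k :: nat
  assume S: "setting E f L \<mu> c a H x y z xstar" and c: "c = 1 / 2" and k: "1 \<le> k"
  have "2 * L * (f (x 0) - f xstar) / (c * (1 - c) * real k)
          = 8 * (L * (f (x 0) - f xstar) / real k)"
    using k by (simp add: c field_simps)
  then show "Min ((\<lambda>i. (norm (grad E f (x i)))\<^sup>2) ` {1..k})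
      \<le> 8 * (L * (f (x 0) - f xstar) / real k)"
    using min_gradient_norm_bound[OF S k] by simp
qed simp_all

end
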